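(* Let $n$ be an integer and let $\{I,A_1,\dots,A_e,B\}$ be a symmetric association scheme on $n^2$ vertices with nontrivial idempotents $F$ and $E_i$, $i=1,\dots,e$, where $B$ is strongly regular of Latin square type (in which case $n$ is positive) or of negative Latin square type (in which case $n$ is negative) with valency $k$, such that $F$ has multiplicity (rank) $k$ and $BF=(n-t)F$, where $t=k/(n-1)$. If $k\neq \frac12(n^2-1)$ and $B$ can be decomposed into strongly regular graphs $B_1,\dots,B_f$ (that is, $B=B_1+\cdots+B_f$ in terms of adjacency matrices) that are all of the same type as $B$ (all of Latin square type if $B$ is, respectively all of negative Latin square type if $B$ is), then $\{I,A_1,\dots,A_e,B_1,\dots,B_f\}$ is an association scheme.
   Context: A $d$-class (symmetric) association scheme is a set of $d+1$ nonzero symmetric $01$-matrices $\{A_0=I,A_1,\dots,A_d\}$ of the same size $v$ (the number of vertices) that sum to the all-ones matrix $J$ and whose span is an algebra (the Bose-Mesner algebra) under ordinary matrix multiplication. The matrices $A_i$ are called the relations of the scheme; for $i\ge 1$ they are identified with the graphs of which they are adjacency matrices. The Bose-Mesner algebra is commutative and has a unique basis of minimal (primitive) idempotents $E_0=\frac1v J,E_1,\dots,E_d$ (projections onto the common eigenspaces); the nontrivial idempotents are those different from $\frac1vJ$. The multiplicity of an idempotent is its rank. A graph is strongly regular if it is one of the (non-identity) relations of a $2$-class association scheme. Its restricted eigenvalues are its eigenvalues on the nontrivial idempotents of that $2$-class scheme. A strongly regular graph on $v$ vertices with valency $k$ is of Latin square type if $v=n^2$, $k=t(n-1)$, and its restricted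 eigenvalues are $n-t$ and $-t$, for some positive integers $n$ and $t$. It is of negative Latin square type if the same holds for some negative integers $n$ and $t$. *)

theory Defs
  imports "HOL-Analysis.Analysis"
begin

text \<open>Vertices are the elements of a finite type; the number of vertices is its cardinality.\<close>

definition all_ones :: "real ^ 'v ^ 'v" where
  "all_ones = (\<chi> x y. 1)"

definition association_scheme :: "nat \<Rightarrow> (real ^ 'v ^ 'v) set \<Rightarrow> bool" where
  "association_scheme d S \<longleftrightarrow>
     finite S \<and> card S = d + 1 \<and> mat 1 \<in> S \<and>
     (\<forall>M\<in>S. M \<noteq> 0 \<and> transpose M = M \<and> (\<forall>x y. M $ x $ y \<in> {0, 1})) \<and>
     (\<Sum>M\<in>S. M) = all_ones \<and>
     (\<forall>M\<in>span S. \<forall>N\<in>span S. M ** N \<in> span S)"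

text \<open>The minimal idempotents of the Bose-Mesner algebra \<open>span S\<close>. Minimality is with respect
  to the usual order \<open>D \<le> E \<longleftrightarrow> E ** D = D\<close> on commuting idempotents.\<close>

definition primitive_idempotents :: "(real ^ 'v ^ 'v) set \<Rightarrow> (real ^ 'v ^ 'v) set" where
  "primitive_idempotents S =
     {E \<in> span S. E \<noteq> 0 \<and> E ** E = E \<and>
        (\<forall>D\<in>span S. D ** D = D \<and> E ** D = D \<longrightarrow> D = 0 \<or> D = E)}"

definition nontrivial_idempotents :: "(real ^ 'v ^ 'v) set \<Rightarrow> (real ^ 'v ^ 'v) set" where
  "nontrivial_idempotents S =
     primitive_idempotents S - {(1 / real CARD('v)) *\<^sub>R all_ones}"

definition has_valency :: "real ^ 'v ^ 'v \<Rightarrow> nat \<Rightarrow> bool" where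
  "has_valency G k \<longleftrightarrow> (\<forall>x. (\<Sum>y\<in>UNIV. G $ x $ y) = real k)"

definition strongly_regular_in :: "(real ^ 'v ^ 'v) set \<Rightarrow> real ^ 'v ^ 'v \<Rightarrow> bool" where
  "strongly_regular_in S G \<longleftrightarrow> association_scheme 2 S \<and> G \<in> S \<and> G \<noteq> mat 1"

definition strongly_regular :: "real ^ 'v ^ 'v \<Rightarrow> bool" where
  "strongly_regular G \<longleftrightarrow> (\<exists>S. strongly_regular_in S G)"

definition restricted_eigenvalues :: "(real ^ 'v ^ 'v) set \<Rightarrow> real ^ 'v ^ 'v \<Rightarrow> real set" where
  "restricted_eigenvalues S G =
     {\<theta>. \<exists>E\<in>nontrivial_idempotents S. G ** E = \<theta> *\<^sub>R E}"

text \<open>The conditions shared by the two types, which differ only in the signs of \<open>n\<close> and \<open>t\<close>.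
  The scheme \<open>S\<close> is necessarily \<open>{mat 1, G, all_ones - mat 1 - G}\<close>, so there is no choice in
  the existential quantifier.\<close>

definition latin_parameters :: "real ^ 'v ^ 'v \<Rightarrow> int \<Rightarrow> int \<Rightarrow> bool" where
  "latin_parameters G n t \<longleftrightarrow>
     int CARD('v) = n\<^sup>2 \<and>
     (\<exists>k. has_valency G k \<and> int k = t * (n - 1)) \<and>
     (\<exists>S. strongly_regular_in S G \<and>
          restricted_eigenvalues S G = {of_int (n - t), of_int (- t)})"

definition latin_square_type :: "real ^ 'v ^ 'v \<Rightarrow> bool" where
  "latin_square_type G \<longleftrightarrow>
     strongly_regular G \<and> (\<exists>n t. n > 0 \<and> t > 0 \<and> latin_parameters G n t)"

definition negative_latin_square_type :: "real ^ 'v ^ 'v \<Rightarrow> bool" where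
  "negative_latin_square_type G \<longleftrightarrow>
     strongly_regular G \<and> (\<exists>n t. n < 0 \<and> t < 0 \<and> latin_parameters G n t)"

end

theory Submission
  imports Defs
begin

text \<open>
  Write \<open>J = all_ones\<close>. The graph \<open>G\<close> of (negative) Latin square type with parameters \<open>n, t\<close> is
  determined by the projection \<open>P\<close> onto its eigenspace for \<open>n - t\<close>: the spectral decomposition
  of \<open>G\<close> collapses to \<open>G = n P - t I + (t / n) J\<close>, and the rank of \<open>P\<close> equals the valency
  \<open>t (n - 1)\<close>. This expression for \<open>G\<close> is linear in the pair of \<open>P\<close> and \<open>t\<close>, with the
  same \<open>n\<close> for every graph involved, and so is compatible with sums of graphs.

  In the theorem, \<open>F\<close> lies in the eigenspace of \<open>B\<close> for \<open>n - t\<close> and has the right rank, so it is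
  the projection of \<open>B\<close> (\<open>latin_projection_eqI\<close>; here the rank of a projection is read off from its
  trace). Let \<open>P\<^sub>i\<close> be the projection of \<open>B\<^sub>i\<close>. Counting valencies in \<open>B = \<Sum> B\<^sub>i\<close> shows that the
  parameters \<open>t\<^sub>i\<close> add up to \<open>t\<close>, so by linearity \<open>F = \<Sum> P\<^sub>i\<close>. A sum of orthogonal projections
  is a projection only if they are mutually orthogonal (\<open>symmetric_idempotent_sum_orthogonal\<close>),
  hence \<open>P\<^sub>i P\<^sub>j = 0\<close> for \<open>i \<noteq> j\<close> and \<open>F P\<^sub>i = P\<^sub>i\<close>.

  Since \<open>F\<close> is primitive, every \<open>A\<close> in the old algebra acts on \<open>F\<close> as a scalar \<open>c\<close>
  (\<open>bose_mesner_eigenvalue\<close>), and then \<open>A P\<^sub>i = A F P\<^sub>i = c P\<^sub>i\<close>. So all products of the new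
  relations with the \<open>P\<^sub>i\<close>, and therefore with the \<open>B\<^sub>i\<close>, stay in the span of the new relations.
  The other axioms of a scheme hold because \<open>01\<close>-matrices with a \<open>01\<close> sum have disjoint supports.
\<close>

section \<open>Matrix arithmetic\<close>

lemma matrix_mult_scaleR_left: "(c *\<^sub>R M) ** N = c *\<^sub>R (M ** (N :: real ^ 'n ^ 'n))"
  for M :: "real ^ 'n ^ 'n"
  by (simp add: scalar_matrix_assoc)

lemma matrix_mult_scaleR_right: "M ** (c *\<^sub>R N) = c *\<^sub>R (M ** (N :: real ^ 'n ^ 'n))"
  for M :: "real ^ 'n ^ 'n"
  by (simp add: matrix_scalar_ac scalar_matrix_assoc)

lemma matrix_mult_diff_left: "(M - N) ** K = M ** K - N ** (K :: real ^ 'n ^ 'n)"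
  for M N :: "real ^ 'n ^ 'n"
  by (simp add: matrix_matrix_mult_def vec_eq_iff left_diff_distrib sum_subtractf)

lemma matrix_mult_diff_right: "K ** (M - N) = K ** M - K ** (N :: real ^ 'n ^ 'n)"
  for M K :: "real ^ 'n ^ 'n"
  by (simp add: matrix_matrix_mult_def vec_eq_iff right_diff_distrib sum_subtractf)

lemma matrix_mult_add_left: "(M + N) ** K = M ** K + N ** (K :: real ^ 'n ^ 'n)"
  for M N :: "real ^ 'n ^ 'n"
  by (simp add: matrix_matrix_mult_def vec_eq_iff distrib_right sum.distrib)

lemma linear_mult_left: "linear (\<lambda>M :: real ^ 'n ^ 'n. K ** M)"
  for K :: "real ^ 'n ^ 'n"
  by (rule linearI) (simp_all add: matrix_add_ldistrib matrix_mult_scaleR_right)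

lemma linear_mult_right: "linear (\<lambda>M :: real ^ 'n ^ 'n. M ** K)"
  for K :: "real ^ 'n ^ 'n"
  by (rule linearI) (simp_all add: matrix_mult_add_left matrix_mult_scaleR_left)

lemma linear_transpose: "linear (transpose :: real ^ 'n ^ 'n \<Rightarrow> real ^ 'n ^ 'n)"
  by (rule linearI) (simp_all add: transpose_def vec_eq_iff)

lemmas matrix_arith = matrix_add_ldistrib matrix_mult_add_left matrix_mult_diff_left matrix_mult_diff_right
  matrix_mult_scaleR_left matrix_mult_scaleR_right

lemma span_mult_closed:
  fixes S :: "(real ^ 'n ^ 'n) set"
  assumes "\<And>M N. M \<in> S \<Longrightarrow> N \<in> S \<Longrightarrow> M ** N \<in> span S"
    and "M \<in> span S" "N \<in> span S"
  shows "M ** N \<in> span S"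
proof -
  have "K ** N \<in> span S" if "K \<in> S" for K
    using linear_subspace_vimage[OF linear_mult_left[of K] subspace_span[of S]] assms(1,3) that
    by (auto simp: vimage_def elim!: span_induct[where P = "\<lambda>X. K ** X \<in> span S"])
  then show ?thesis
    using linear_subspace_vimage[OF linear_mult_right[of N] subspace_span[of S]] assms(2)
    by (auto simp: vimage_def elim!: span_induct[where P = "\<lambda>X. X ** N \<in> span S"])
qed

lemma all_ones_sq: "all_ones ** all_ones = real CARD('v) *\<^sub>R (all_ones :: real ^ 'v ^ 'v)"
  by (simp add: all_ones_def matrix_matrix_mult_def vec_eq_iff)

lemma transpose_all_ones [simp]: "transpose all_ones = (all_ones :: real ^ 'v ^ 'v)"
  by (simp add: all_ones_def transpose_def vec_eq_iff)

lemma valency_mult_all_ones: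
  fixes G :: "real ^ 'v ^ 'v"
  assumes "has_valency G k"
  shows "G ** all_ones = real k *\<^sub>R all_ones"
  using assms by (simp add: has_valency_def all_ones_def matrix_matrix_mult_def vec_eq_iff)

section \<open>Symmetric idempotent matrices\<close>

definition symmetric_idempotent :: "real ^ 'n ^ 'n \<Rightarrow> bool" where
  "symmetric_idempotent P \<longleftrightarrow> transpose P = P \<and> P ** P = P"

lemma inner_symmetric_matrix:
  fixes M :: "real ^ 'n ^ 'n"
  assumes "transpose M = M"
  shows "x \<bullet> (M *v y) = (M *v x) \<bullet> y"
  by (metis assms dot_lmul_matrix vector_transpose_matrix)

lemma symmetric_idempotent_inner:
  fixes P :: "real ^ 'n ^ 'n"
  assumes "symmetric_idempotent P"
  shows "x \<bullet> (P *v x) = (P *v x) \<bullet> (P *v x)"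
  using assms inner_symmetric_matrix[of P x "P *v x"]
  by (simp add: symmetric_idempotent_def matrix_vector_mul_assoc)

text \<open>With respect to an orthonormal basis \<open>U\<close> of its range, \<open>P\<close> is the sum of \<open>u u\<^sup>T\<close> over \<open>u\<close> in \<open>U\<close>,
  and each summand has trace \<open>u \<bullet> u = 1\<close>.\<close>

lemma symmetric_idempotent_trace_eq_rank:
  fixes P :: "real ^ 'n ^ 'n"
  assumes "symmetric_idempotent P"
  shows "trace P = real (rank P)"
proof -
  have tr: "transpose P = P" and idem: "P ** P = P"
    using assms by (auto simp: symmetric_idempotent_def)
  have "subspace (range (\<lambda>x. P *v x))"
    by (simp add: linear_subspace_image)
  then obtain U where U: "U \<subseteq> range (\<lambda>x. P *v x)" "pairwise orthogonal U"
    "\<And>u. u \<in> U \<Longrightarrow> norm u = 1" "independent U" "card U = dim (range (\<lambda>x. P *v x))"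
    "span U = range (\<lambda>x. P *v x)"
    using orthonormal_basis_subspace by metis
  have fin: "finite U"
    using U(4) independent_imp_finite by blast
  have fix_u: "P *v u = u" if "u \<in> U" for u
    using U(1) that idem by (auto simp: matrix_vector_mul_assoc)
  have "P *v x = (\<Sum>u\<in>U. (x \<bullet> u) *\<^sub>R u)" for x
  proof -
    have "(\<Sum>u\<in>U. ((P *v x) \<bullet> u) *\<^sub>R u) = P *v x"
      using U fin by (intro orthonormal_basis_expand) auto
    moreover have "(P *v x) \<bullet> u = x \<bullet> u" if "u \<in> U" for u
      using inner_symmetric_matrix[OF tr, of x u] fix_u[OF that] by simp
    ultimately show ?thesis by simp
  qed
  moreover have "P $ i $ i = (P *v axis i 1) $ i" for i
    by (simp add: matrix_vector_mul_component inner_axis)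
  ultimately have "P $ i $ i = (\<Sum>u\<in>U. u $ i * u $ i)" for i
    by (simp add: inner_axis inner_commute)
  then have "trace P = (\<Sum>u\<in>U. u \<bullet> u)"
    unfolding trace_def inner_vec_def by (simp add: sum.swap[of _ U])
  also have "\<dots> = real (card U)"
    using U(3) by (simp add: dot_square_norm)
  finally show ?thesis
    using U(5) by (simp add: rank_dim_range)
qed

text \<open>The hypothesis \<open>Q ** P = P\<close> puts the range of \<open>P\<close> into that of \<open>Q\<close>; by the ranks the ranges
  agree, and an orthogonal projection is determined by its range.\<close>

lemma symmetric_idempotent_eqI:
  fixes P Q :: "real ^ 'n ^ 'n"
  assumes P: "symmetric_idempotent P" and Q: "symmetric_idempotent Q"
    and "Q ** P = P" and "rank P = rank Q"
  shows "P = Q"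
proof -
  have "range (\<lambda>x. P *v x) \<subseteq> range (\<lambda>x. Q *v x)"
    using \<open>Q ** P = P\<close> by (metis image_subset_iff matrix_vector_mul_assoc rangeI)
  then have ranges: "range (\<lambda>x. P *v x) = range (\<lambda>x. Q *v x)"
    using \<open>rank P = rank Q\<close>
    by (intro subspace_dim_equal) (simp_all add: linear_subspace_image rank_dim_range)
  have "P *v (Q *v x) = Q *v x" for x
  proof -
    obtain y where "Q *v x = P *v y"
      using ranges by (metis (no_types, lifting) imageE rangeI)
    then show ?thesis
      using P by (simp add: matrix_vector_mul_assoc symmetric_idempotent_def)
  qed
  then have "P ** Q = Q"
    by (simp add: matrix_eq matrix_vector_mul_assoc)
  then have "transpose Q ** transpose P = transpose Q"
    by (metis matrix_transpose_mul)
  then show ?thesis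
    using assms by (simp add: symmetric_idempotent_def)
qed

text \<open>For \<open>x\<close> in the range of \<open>P i\<close>, the squared lengths of all the \<open>P l *v x\<close> add up to
  \<open>x \<bullet> (Q *v x)\<close>, where \<open>Q\<close> is the sum of the projections. As \<open>Q\<close> is a projection, this is at most
  \<open>x \<bullet> x\<close>, which the term \<open>l = i\<close> already uses up.\<close>

lemma symmetric_idempotent_sum_orthogonal:
  fixes P :: "'i \<Rightarrow> real ^ 'n ^ 'n"
  assumes fin: "finite I" and P: "\<And>i. i \<in> I \<Longrightarrow> symmetric_idempotent (P i)"
    and sum: "symmetric_idempotent (\<Sum>i\<in>I. P i)"
    and ij: "i \<in> I" "j \<in> I" "i \<noteq> j"
  shows "P j ** P i = 0"
proof -
  let ?Q = "\<Sum>i\<in>I. P i"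
  have "P j *v (P i *v y) = 0" for y
  proof -
    define x where "x = P i *v y"
    have "P i *v x = x"
      using P[OF ij(1)] by (simp add: x_def matrix_vector_mul_assoc symmetric_idempotent_def)
    have "?Q *v x = (\<Sum>l\<in>I. P l *v x)"
      using fin by (induction I rule: finite_induct) (simp_all add: matrix_vector_mult_add_rdistrib)
    then have "x \<bullet> (?Q *v x) = (\<Sum>l\<in>I. (P l *v x) \<bullet> (P l *v x))"
      using P by (simp add: inner_sum_right symmetric_idempotent_inner)
    also have "\<dots> \<ge> (\<Sum>l\<in>{i, j}. (P l *v x) \<bullet> (P l *v x))"
      using fin ij by (intro sum_mono2) auto
    finally have "x \<bullet> x + (P j *v x) \<bullet> (P j *v x) \<le> x \<bullet> (?Q *v x)"
      using ij(3) \<open>P i *v x = x\<close> by simp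
    moreover have "x \<bullet> (?Q *v x) \<le> x \<bullet> x"
    proof -
      \<comment> \<open>\<open>x\<close> splits orthogonally into \<open>?Q *v x\<close> and the rest.\<close>
      have "0 \<le> (x - ?Q *v x) \<bullet> (x - ?Q *v x)"
        by simp
      also have "\<dots> = x \<bullet> x - x \<bullet> (?Q *v x)"
        using symmetric_idempotent_inner[OF sum, of x]
        by (simp add: inner_diff_left inner_diff_right inner_commute)
      finally show ?thesis by simp
    qed
    ultimately have "(P j *v x) \<bullet> (P j *v x) \<le> 0"
      by simp
    then show ?thesis
      by (metis inner_eq_zero_iff inner_ge_zero order_antisym x_def)
  qed
  then show ?thesis
    by (simp add: matrix_eq matrix_vector_mul_assoc)
qed

text \<open>Rayleigh's principle: a maximiser of \<open>x \<bullet> (X *v x)\<close> on the unit sphere of the range of \<open>P\<close> is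
  an eigenvector.\<close>

lemma symmetric_matrix_eigenvector_on_range:
  fixes X P :: "real ^ 'n ^ 'n"
  assumes X: "transpose X = X" and PX: "P ** X = X" and P: "symmetric_idempotent P" and "P \<noteq> 0"
  obtains c x where "x \<noteq> 0" "P *v x = x" "X *v x = c *\<^sub>R x"
proof -
  define R where "R = range (\<lambda>x. P *v x)"
  have sub: "subspace R"
    by (simp add: R_def linear_subspace_image)
  have R_iff: "x \<in> R \<longleftrightarrow> P *v x = x" for x
    using P by (auto simp: R_def symmetric_idempotent_def matrix_vector_mul_assoc) (metis rangeI)
  let ?K = "R \<inter> sphere 0 1"
  have "compact ?K"
    by (simp add: closed_Int_compact closed_subspace sub)
  moreover have "?K \<noteq> {}"
  proof -
    obtain y where "P *v y \<noteq> 0"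
      using \<open>P \<noteq> 0\<close> by (metis matrix_eq matrix_vector_mult_0)
    then have "(1 / norm (P *v y)) *\<^sub>R (P *v y) \<in> ?K"
      using sub by (auto simp: R_def subspace_scale)
    then show ?thesis by blast
  qed
  moreover have "continuous_on ?K (\<lambda>x. x \<bullet> (X *v x))"
    by (intro continuous_intros linear_continuous_on_compose[OF _ matrix_vector_mul_linear])
  ultimately obtain x0 where x0: "x0 \<in> ?K" and max: "\<And>x. x \<in> ?K \<Longrightarrow> x \<bullet> (X *v x) \<le> x0 \<bullet> (X *v x0)"
    using continuous_attains_sup[of ?K "\<lambda>x. x \<bullet> (X *v x)"] by blast
  define c where "c = x0 \<bullet> (X *v x0)"
  define z where "z = c *\<^sub>R x0 - X *v x0"
  have bound: "x \<bullet> (X *v x) \<le> c * (x \<bullet> x)" if "x \<in> R" for x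
  proof (cases "x = 0")
    case False
    define u where "u = (1 / norm x) *\<^sub>R x"
    have "u \<in> ?K"
      using that False sub by (auto simp: u_def subspace_scale)
    then have "(u \<bullet> (X *v u)) * (norm x)\<^sup>2 \<le> c * (norm x)\<^sup>2"
      using max by (intro mult_right_mono) (auto simp: c_def)
    moreover have "(u \<bullet> (X *v u)) * (norm x)\<^sup>2 = x \<bullet> (X *v x)"
      using False by (simp add: u_def matrix_vector_mult_scaleR power2_eq_square)
    ultimately show ?thesis
      by (simp add: power2_norm_eq_inner)
  qed simp
  have "x0 \<in> R" and norm_x0: "x0 \<bullet> x0 = 1"
    using x0 by (auto simp: dot_square_norm)
  have "X *v x0 \<in> R"
    using PX by (simp add: R_iff matrix_vector_mul_assoc)
  then have "z \<in> R"
    using sub \<open>x0 \<in> R\<close> by (simp add: z_def subspace_diff subspace_scale)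
  have "z = 0"
  proof (rule ccontr)
    assume "z \<noteq> 0"
    define q where "q = c * (z \<bullet> z) - z \<bullet> (X *v z)"
    \<comment> \<open>The form \<open>c * (x \<bullet> x) - x \<bullet> (X *v x)\<close> is nonnegative and vanishes at \<open>x0\<close>,
      so its derivative there in the direction \<open>z\<close>, which is \<open>2 * (z \<bullet> z)\<close>, is zero.\<close>
    have key: "0 \<le> 2 * s * (z \<bullet> z) + s\<^sup>2 * q" for s
    proof -
      have "x0 + s *\<^sub>R z \<in> R"
        using sub \<open>x0 \<in> R\<close> \<open>z \<in> R\<close> by (simp add: subspace_add subspace_scale)
      from bound[OF this]
      have "0 \<le> c * ((x0 + s *\<^sub>R z) \<bullet> (x0 + s *\<^sub>R z)) - (x0 + s *\<^sub>R z) \<bullet> (X *v (x0 + s *\<^sub>R z))"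
        by simp
      also have "\<dots> = (c * (x0 \<bullet> x0) - x0 \<bullet> (X *v x0)) + 2 * s * (z \<bullet> (c *\<^sub>R x0 - X *v x0)) + s\<^sup>2 * q"
        using inner_symmetric_matrix[OF X, of x0 z]
        by (simp add: q_def algebra_simps matrix_vector_right_distrib matrix_vector_mult_scaleR
            inner_commute power2_eq_square)
      also have "\<dots> = 2 * s * (z \<bullet> z) + s\<^sup>2 * q"
        using norm_x0 by (simp add: c_def z_def)
      finally show ?thesis .
    qed
    have "z \<bullet> z > 0"
      using \<open>z \<noteq> 0\<close> by simp
    \<comment> \<open>A negative \<open>s\<close> small enough for the linear term to dominate the quadratic one.\<close>
    define s where "s = - (z \<bullet> z) / (1 + \<bar>q\<bar>)"
    have "2 * s * (z \<bullet> z) + s\<^sup>2 * q = s * (2 * (z \<bullet> z) + s * q)"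
      by (simp add: power2_eq_square algebra_simps)
    moreover have "\<bar>s * q\<bar> \<le> z \<bullet> z"
      using \<open>z \<bullet> z > 0\<close> by (simp add: s_def abs_mult field_simps)
    then have "2 * (z \<bullet> z) + s * q > 0"
      using \<open>z \<bullet> z > 0\<close> by linarith
    moreover have "s < 0"
      using \<open>z \<bullet> z > 0\<close> by (simp add: s_def divide_neg_pos)
    ultimately show False
      using key[of s] by (simp add: mult_less_0_iff zero_le_mult_iff)
  qed
  then have "X *v x0 = c *\<^sub>R x0"
    by (simp add: z_def)
  moreover have "x0 \<noteq> 0"
    using norm_x0 by auto
  ultimately show thesis
    using that \<open>x0 \<in> R\<close> R_iff by blast
qed

section \<open>The Bose-Mesner algebra\<close>

lemma association_schemeD:
  fixes S :: "(real ^ 'v ^ 'v) set"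
  assumes "association_scheme d S"
  shows "finite S" "card S = d + 1" "mat 1 \<in> S" "(\<Sum>M\<in>S. M) = all_ones"
    and "\<And>M. M \<in> S \<Longrightarrow> M \<noteq> 0" "\<And>M. M \<in> S \<Longrightarrow> transpose M = M"
    and "\<And>M x y. M \<in> S \<Longrightarrow> M $ x $ y \<in> {0, 1}"
  using assms by (auto simp: association_scheme_def)

context
  fixes d :: nat and S :: "(real ^ 'v ^ 'v) set"
  assumes scheme: "association_scheme d S"
begin

lemma bose_mesner_mult: "M \<in> span S \<Longrightarrow> N \<in> span S \<Longrightarrow> M ** N \<in> span S"
  using scheme by (auto simp: association_scheme_def)

lemma bose_mesner_all_ones: "all_ones \<in> span S"
proof -
  have "(\<Sum>M\<in>S. M) \<in> span S"
    by (intro span_sum span_base)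
  then show ?thesis
    using scheme by (simp add: association_scheme_def)
qed

lemma bose_mesner_symmetric:
  assumes "M \<in> span S"
  shows "transpose M = M"
  using linear_eq_on_span[OF linear_transpose linear_ident _ assms] scheme
  by (auto simp: association_scheme_def)

lemma bose_mesner_commute:
  assumes "M \<in> span S" "N \<in> span S"
  shows "M ** N = N ** M"
  by (metis assms bose_mesner_mult bose_mesner_symmetric matrix_transpose_mul)

lemma bose_mesner_mult_all_ones:
  assumes "M \<in> span S"
  obtains r where "M ** all_ones = r *\<^sub>R all_ones"
proof -
  have "(\<Sum>y\<in>UNIV. M $ x $ y) = (\<Sum>x\<in>UNIV. M $ x $ z)" for x z
    using bose_mesner_commute[OF assms bose_mesner_all_ones]
    by (simp add: all_ones_def matrix_matrix_mult_def vec_eq_iff)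
  then have "M ** all_ones = (\<Sum>x\<in>UNIV. M $ x $ undefined) *\<^sub>R all_ones"
    by (simp add: all_ones_def matrix_matrix_mult_def vec_eq_iff)
  then show thesis ..
qed

lemma primitive_symmetric_idempotent:
  "P \<in> primitive_idempotents S \<Longrightarrow> symmetric_idempotent P"
  using bose_mesner_symmetric by (auto simp: primitive_idempotents_def symmetric_idempotent_def)

text \<open>All row sums of \<open>P\<close> equal some \<open>r\<close>, and \<open>r\<^sup>2 = r\<close> by idempotence. If \<open>r\<close> were 1, then \<open>J / v\<close> would
  be an idempotent below \<open>P\<close> and different from it, against minimality.\<close>

lemma nontrivial_idempotent_mult_all_ones:
  assumes "P \<in> nontrivial_idempotents S"
  shows "P ** all_ones = 0"
proof -
  have P: "P \<in> span S" "P ** P = P" "P \<noteq> (1 / real CARD('v)) *\<^sub>R all_ones"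
    and min: "\<And>D. D \<in> span S \<Longrightarrow> D ** D = D \<Longrightarrow> P ** D = D \<Longrightarrow> D = 0 \<or> D = P"
    using assms by (auto simp: nontrivial_idempotents_def primitive_idempotents_def)
  obtain r where r: "P ** all_ones = r *\<^sub>R all_ones"
    using bose_mesner_mult_all_ones[OF P(1)] .
  have "r *\<^sub>R r *\<^sub>R all_ones = r *\<^sub>R (all_ones :: real ^ 'v ^ 'v)"
    by (metis P(2) r matrix_mul_assoc matrix_mult_scaleR_right)
  then have "r * r = r"
    by (simp add: all_ones_def vec_eq_iff)
  moreover have "r \<noteq> 1"
  proof
    assume "r = 1"
    let ?D = "(1 / real CARD('v)) *\<^sub>R all_ones :: real ^ 'v ^ 'v"
    have "?D \<in> span S"
      by (simp add: bose_mesner_all_ones span_scale)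
    moreover have "?D ** ?D = ?D"
      by (simp add: matrix_mult_scaleR_left matrix_mult_scaleR_right all_ones_sq)
    moreover have "P ** ?D = ?D"
      using r \<open>r = 1\<close> by (simp add: matrix_mult_scaleR_right)
    ultimately have "?D = 0"
      using min P(3) by metis
    then show False
      by (simp add: all_ones_def vec_eq_iff)
  qed
  ultimately have "r = 0"
    by simp
  then show ?thesis
    using r by simp
qed

text \<open>The ideal cut out by a minimal idempotent \<open>P\<close> is a field. Multiplication by a symmetric
  \<open>Y\<close> is injective on its own image, because \<open>Y ** Y ** K = 0\<close> forces \<open>Y ** K\<close> to have zero norm. By
  dimension it maps that image onto itself, so \<open>Y = Y ** Y ** M\<close> for some \<open>M\<close>. Then \<open>Y ** M\<close> is a
  nonzero idempotent below \<open>P\<close>, hence \<open>P\<close> itself.\<close>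

lemma bose_mesner_corner_invertible:
  assumes P: "P \<in> primitive_idempotents S"
    and Y: "Y \<in> span S" "P ** Y = Y" "Y \<noteq> 0"
  obtains M where "M ** Y = P"
proof -
  have Pspan: "P \<in> span S"
    and min: "\<And>D. D \<in> span S \<Longrightarrow> D ** D = D \<Longrightarrow> P ** D = D \<Longrightarrow> D = 0 \<or> D = P"
    using P by (auto simp: primitive_idempotents_def)
  let ?L = "\<lambda>M. Y ** M"
  let ?W = "?L ` span S"
  have sub: "subspace ?W"
    by (intro linear_subspace_image linear_mult_left subspace_span)
  have W_span: "?W \<subseteq> span S"
    using bose_mesner_mult Y(1) by auto
  have "inj_on ?L ?W"
  proof (rule inj_onI)
    fix M N assume "M \<in> ?W" "N \<in> ?W" and eq: "Y ** M = Y ** N"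
    then have "M - N \<in> ?W"
      using sub subspace_diff by blast
    then obtain K where K: "K \<in> span S" "M - N = Y ** K"
      by blast
    have YY: "Y ** (Y ** K) = 0"
      using eq K(2) by (metis diff_self matrix_mult_diff_right)
    have "transpose (Y ** K) ** (Y ** K) = 0"
    proof -
      have "transpose (Y ** K) = Y ** K"
        using K(1) Y(1) bose_mesner_mult bose_mesner_symmetric by blast
      also have "\<dots> = K ** Y"
        using K(1) Y(1) bose_mesner_commute by blast
      finally show ?thesis
        using YY by (simp flip: matrix_mul_assoc)
    qed
    then have "column i (Y ** K) \<bullet> column i (Y ** K) = 0" for i
      by (simp add: matrix_mult_transpose_dot_column vec_eq_iff)
    then have "Y ** K = 0"
      by (simp add: column_def vec_eq_iff)
    then show "M = N"
      using K(2) by simp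
  qed
  then have "dim (?L ` ?W) = dim ?W"
    using sub by (intro dim_image_eq linear_mult_left) (simp add: span_eq_iff[THEN iffD2])
  then have "?L ` ?W = ?W"
    using sub W_span by (intro subspace_dim_equal linear_subspace_image linear_mult_left) auto
  moreover have "Y \<in> ?W"
    using Pspan Y bose_mesner_commute by (metis image_eqI)
  ultimately obtain M where M: "M \<in> span S" "Y = Y ** (Y ** M)"
    by blast
  define D where "D = Y ** M"
  have D: "D \<in> span S"
    using M(1) Y(1) bose_mesner_mult by (simp add: D_def)
  have "D ** D = D"
    using M Y(1) by (metis D_def bose_mesner_commute matrix_mul_assoc)
  moreover have "P ** D = D"
    using Y(2) by (simp add: D_def matrix_mul_assoc)
  moreover have "D \<noteq> 0"
    using M(2) Y(3) by (auto simp: D_def)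
  ultimately have "D = P"
    using min D by blast
  then show thesis
    using that[of M] M(1) Y(1) bose_mesner_commute by (metis D_def)
qed

text \<open>Subtracting from \<open>X ** P\<close> the multiple \<open>c *\<^sub>R P\<close> for an eigenvalue \<open>c\<close> of \<open>X\<close> on the range of \<open>P\<close>
  leaves an element that kills an eigenvector in that range. It is not invertible there, so it
  is 0.\<close>

lemma bose_mesner_eigenvalue:
  assumes P: "P \<in> primitive_idempotents S" and X: "X \<in> span S"
  obtains c where "X ** P = c *\<^sub>R P"
proof -
  have Pspan: "P \<in> span S" and "P \<noteq> 0" and idem: "P ** P = P"
    using P by (auto simp: primitive_idempotents_def)
  have XP: "X ** P \<in> span S" "P ** (X ** P) = X ** P"
    using X Pspan idem bose_mesner_mult bose_mesner_commute by (metis, metis matrix_mul_assoc)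
  obtain c x where x: "x \<noteq> 0" "P *v x = x" "(X ** P) *v x = c *\<^sub>R x"
    using symmetric_matrix_eigenvector_on_range[OF bose_mesner_symmetric[OF XP(1)] XP(2)
        primitive_symmetric_idempotent[OF P] \<open>P \<noteq> 0\<close>] .
  define Y where "Y = X ** P - c *\<^sub>R P"
  have "Y = 0"
  proof (rule ccontr)
    assume "Y \<noteq> 0"
    moreover have "Y \<in> span S"
      using XP(1) Pspan by (simp add: Y_def span_diff span_scale)
    moreover have "P ** Y = Y"
      using XP(2) idem by (simp add: Y_def matrix_mult_diff_right matrix_mult_scaleR_right)
    ultimately obtain M where "M ** Y = P"
      using bose_mesner_corner_invertible[OF P] by metis
    moreover have "Y *v x = 0"
      using x by (simp add: Y_def matrix_vector_mult_diff_rdistrib scaleR_matrix_vector_assoc[symmetric])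
    ultimately have "P *v x = 0"
      by (metis matrix_vector_mul_assoc matrix_vector_mult_0_right)
    then show False
      using x by simp
  qed
  then show thesis
    using that[of c] by (simp add: Y_def)
qed

end

section \<open>The eigenprojection of a Latin square type graph\<close>

lemma strongly_regular_in_entries:
  assumes "strongly_regular_in S G"
  shows "G \<noteq> 0" "transpose G = G" "G $ x $ y \<in> {0, 1}" "G $ x $ x = 0"
proof -
  have fin: "finite S" and mem: "mat 1 \<in> S" "G \<in> S" "G \<noteq> mat 1"
    and entries: "\<And>M x y. M \<in> S \<Longrightarrow> M $ x $ y \<in> {0, 1}" and sum: "(\<Sum>M\<in>S. M) = all_ones"
    and G: "G \<noteq> 0" "transpose G = G"
    using assms by (auto simp: strongly_regular_in_def association_scheme_def)
  have nonneg: "0 \<le> M $ x $ x" if "M \<in> S" for M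
    using entries[OF that, of x x] by auto
  have "(\<Sum>M\<in>{mat 1, G}. M $ x $ x) \<le> (\<Sum>M\<in>S. M $ x $ x)"
    using fin mem nonneg by (intro sum_mono2) auto
  also have "\<dots> = 1"
    using arg_cong[OF sum, of "\<lambda>M. M $ x $ x"] by (simp add: all_ones_def)
  finally have "G $ x $ x \<le> 0"
    using mem(3) by (simp add: mat_def)
  then show "G $ x $ x = 0"
    using entries[OF mem(2), of x x] by auto
qed (use assms in \<open>auto simp: strongly_regular_in_def association_scheme_def\<close>)

text \<open>The third relation is \<open>J - I - G\<close>, so the Bose-Mesner algebra of a strongly regular graph \<open>G\<close> is
  spanned by \<open>I\<close>, \<open>G\<close> and \<open>J\<close>.\<close>

lemma strongly_regular_in_span:
  assumes "strongly_regular_in S G" "X \<in> span S"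
  obtains a b c where "X = a *\<^sub>R mat 1 + b *\<^sub>R G + c *\<^sub>R all_ones"
proof -
  have S: "finite S" "card S = 3" "mat 1 \<in> S" "G \<in> S" "G \<noteq> mat 1" and sum: "(\<Sum>M\<in>S. M) = all_ones"
    using assms by (auto simp: strongly_regular_in_def association_scheme_def)
  have "card (S - {mat 1, G}) = 1"
    using S by (simp add: card_Diff_subset)
  then obtain H where "S - {mat 1, G} = {H}"
    using card_1_singletonE by blast
  then have H: "S = {mat 1, G, H}" "H \<noteq> mat 1" "H \<noteq> G"
    using S by auto
  then have H_eq: "H = all_ones - mat 1 - G"
    using sum S(5) by (simp add: algebra_simps)
  obtain a b c where "X - a *\<^sub>R mat 1 - b *\<^sub>R G - c *\<^sub>R H = 0"
    using assms(2) unfolding H(1) by (auto simp: span_insert)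
  then have "X = a *\<^sub>R mat 1 + b *\<^sub>R G + c *\<^sub>R H"
    by (simp add: algebra_simps)
  also have "\<dots> = (a - c) *\<^sub>R mat 1 + (b - c) *\<^sub>R G + c *\<^sub>R all_ones"
    unfolding H_eq by (simp add: algebra_simps)
  finally have "X = (a - c) *\<^sub>R mat 1 + (b - c) *\<^sub>R G + c *\<^sub>R all_ones" .
  then show thesis ..
qed

text \<open>The solution \<open>P\<close> of \<open>G = n P - t I + (t / n) J\<close>. For a graph with \<open>latin_parameters G n t\<close> it is the
  projection onto the eigenspace for the restricted eigenvalue \<open>n - t\<close>.\<close>

definition latin_projection :: "real \<Rightarrow> real \<Rightarrow> real ^ 'v ^ 'v \<Rightarrow> real ^ 'v ^ 'v" where
  "latin_projection n t G = (1 / n) *\<^sub>R (G + t *\<^sub>R mat 1 - (t / n) *\<^sub>R all_ones)"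

lemma latin_projection_inverse:
  assumes "n \<noteq> 0"
  shows "G = n *\<^sub>R latin_projection n t G - t *\<^sub>R mat 1 + (t / n) *\<^sub>R all_ones"
  using assms by (simp add: latin_projection_def)

context
  fixes n t :: int and G :: "real ^ 'v ^ 'v"
  assumes latin: "latin_parameters G n t"
begin

lemma latin_parameters_card: "real CARD('v) = real_of_int n ^ 2"
proof -
  have "int CARD('v) = n\<^sup>2"
    using latin by (simp add: latin_parameters_def)
  then show ?thesis
    by (metis of_int_of_nat_eq of_int_power)
qed

lemma latin_parameters_nonzero: "n \<noteq> 0"
  using latin by (auto simp: latin_parameters_def)

lemma latin_parameters_valency:
  assumes "has_valency G k"
  shows "real k = t * (real_of_int n - 1)"
proof -
  obtain k' where k': "has_valency G k'" "int k' = t * (n - 1)"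
    using latin by (auto simp: latin_parameters_def)
  then have "k = k'"
    using assms by (simp add: has_valency_def)
  then show ?thesis
    using k'(2) by (metis of_int_1 of_int_diff of_int_mult of_int_of_nat_eq)
qed

lemma latin_parameters_mult_all_ones:
  "G ** all_ones = (t * (real_of_int n - 1)) *\<^sub>R all_ones"
  using latin latin_parameters_valency valency_mult_all_ones[of G]
  by (auto simp: latin_parameters_def)

lemma latin_parameters_entries:
  "G \<noteq> 0" "transpose G = G" "G $ x $ y \<in> {0, 1}" "G $ x $ x = 0"
proof -
  obtain S where S: "strongly_regular_in S G"
    using latin by (auto simp: latin_parameters_def)
  show "G \<noteq> 0" "transpose G = G" "G $ x $ y \<in> {0, 1}" "G $ x $ x = 0"
    by (fact strongly_regular_in_entries[OF S])+
qed

text \<open>By the two-class structure \<open>G\<^sup>2 = a I + b G + c J\<close>. Both restricted eigenvalues \<open>n - t\<close> and \<open>-t\<close> are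
  roots of \<open>x\<^sup>2 = a + b x\<close>, since \<open>J\<close> vanishes on nontrivial idempotents; they are distinct, which
  fixes \<open>a\<close> and \<open>b\<close>.\<close>

lemma latin_parameters_quadratic:
  obtains c where
    "G ** G = (n * (real_of_int t) - t * t) *\<^sub>R mat 1 + (n - 2 * real_of_int t) *\<^sub>R G + c *\<^sub>R all_ones"
proof -
  obtain S where S: "strongly_regular_in S G"
    and ev: "restricted_eigenvalues S G = {of_int (n - t), of_int (- t)}"
    using latin by (auto simp: latin_parameters_def)
  have scheme: "association_scheme 2 S" and "G \<in> S"
    using S by (auto simp: strongly_regular_in_def)
  have "G ** G \<in> span S"
    using bose_mesner_mult[OF scheme] \<open>G \<in> S\<close> by (simp add: span_base)
  then obtain a b c where abc: "G ** G = a *\<^sub>R mat 1 + b *\<^sub>R G + c *\<^sub>R all_ones"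
    using strongly_regular_in_span[OF S] by metis
  have quad: "\<theta> * \<theta> = a + b * \<theta>" if \<theta>: "\<theta> \<in> restricted_eigenvalues S G" for \<theta>
  proof -
    obtain P where P: "P \<in> nontrivial_idempotents S" "G ** P = \<theta> *\<^sub>R P"
      using \<theta> by (auto simp: restricted_eigenvalues_def)
    have "P \<noteq> 0" "P \<in> span S"
      using P(1) by (auto simp: nontrivial_idempotents_def primitive_idempotents_def)
    then have "all_ones ** P = 0"
      using bose_mesner_commute[OF scheme] bose_mesner_all_ones[OF scheme]
        nontrivial_idempotent_mult_all_ones[OF scheme P(1)] by metis
    then have "(G ** G) ** P = (a + b * \<theta>) *\<^sub>R P"
      by (simp add: abc matrix_arith P(2) algebra_simps)
    moreover have "(G ** G) ** P = (\<theta> * \<theta>) *\<^sub>R P"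
      by (simp add: matrix_arith P(2) flip: matrix_mul_assoc)
    ultimately show ?thesis
      using \<open>P \<noteq> 0\<close> by simp
  qed
  have 1: "(n - real_of_int t) * (n - t) = a + b * (n - t)" and 2: "real_of_int t * t = a - b * t"
    using quad[of "of_int (n - t)"] quad[of "of_int (- t)"] by (simp_all add: ev)
  have "real_of_int n * (b - (n - 2 * t)) = 0"
    using 1 2 by (simp add: algebra_simps)
  then have b: "b = n - 2 * real_of_int t"
    using latin_parameters_nonzero by simp
  then have "a = n * real_of_int t - t * t"
    using 2 unfolding b by (simp add: algebra_simps)
  then show thesis
    using abc b that[of c] by simp
qed

lemma latin_projection_mult_all_ones: "latin_projection n t G ** all_ones = 0"
  using latin_parameters_nonzero
  by (simp add: latin_projection_def matrix_arith latin_parameters_mult_all_ones all_ones_sq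
      latin_parameters_card power2_eq_square algebra_simps)

lemma latin_projection_symmetric: "transpose (latin_projection n t G) = latin_projection n t G"
  by (simp add: latin_projection_def transpose_scalar latin_parameters_entries
      linear_add[OF linear_transpose] linear_diff[OF linear_transpose])

lemma all_ones_mult_latin_projection: "all_ones ** latin_projection n t G = 0"
proof -
  have "transpose (latin_projection n t G ** all_ones) = all_ones ** latin_projection n t G"
    by (simp add: matrix_transpose_mul latin_projection_symmetric)
  then show ?thesis
    by (simp add: latin_projection_mult_all_ones linear_0[OF linear_transpose])
qed

text \<open>The two restricted eigenvalues satisfy \<open>(G - (n - t) I) (G + t I) = c J\<close>, and \<open>n P\<close> differs from
  \<open>G + t I\<close> by a multiple of \<open>J\<close>. So \<open>G P = (n - t) P\<close> up to a multiple of \<open>J\<close>, which is 0 because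
  \<open>P J = 0\<close>. Substituting \<open>G = n P - t I + (t / n) J\<close> on the left gives \<open>P\<^sup>2 = P\<close>.\<close>

lemma latin_projection_symmetric_idempotent: "symmetric_idempotent (latin_projection n t G)"
proof -
  define P where "P = latin_projection n t G"
  have n: "real_of_int n \<noteq> 0"
    using latin_parameters_nonzero by simp
  have G: "G = n *\<^sub>R P - t *\<^sub>R mat 1 + (t / n) *\<^sub>R all_ones"
    using latin_projection_inverse[OF n] by (simp add: P_def)
  have PJ: "P ** all_ones = 0"
    by (simp add: P_def latin_projection_mult_all_ones)
  have "G ** P = n *\<^sub>R (P ** P) - t *\<^sub>R P + (t / n) *\<^sub>R (all_ones ** P)"
    by (subst G) (simp add: matrix_arith)
  then have GP: "G ** P = n *\<^sub>R (P ** P) - t *\<^sub>R P"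
    by (simp add: P_def all_ones_mult_latin_projection)
  obtain c where c: "G ** G = (n * real_of_int t - t * t) *\<^sub>R mat 1 + (n - 2 * real_of_int t) *\<^sub>R G + c *\<^sub>R all_ones"
    using latin_parameters_quadratic by blast
  define c' where "c' = (n - real_of_int t) * t / n\<^sup>2 + (c - t / n * (t * (real_of_int n - 1))) / n"
  have "G ** P = (1 / n) *\<^sub>R (G ** G + t *\<^sub>R G - (t / n * (t * (real_of_int n - 1))) *\<^sub>R all_ones)"
    by (simp add: P_def latin_projection_def matrix_arith latin_parameters_mult_all_ones)
  also have "\<dots> = (n - real_of_int t) *\<^sub>R P + c' *\<^sub>R all_ones"
    using n by (simp add: c c'_def P_def latin_projection_def vec_eq_iff all_ones_def field_simps power2_eq_square)
  finally have GP': "G ** P = (n - real_of_int t) *\<^sub>R P + c' *\<^sub>R all_ones" .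
  \<comment> \<open>Multiplying by \<open>all_ones\<close> kills both \<open>P\<close> terms.\<close>
  have "c' *\<^sub>R (all_ones ** all_ones) = (G ** P) ** all_ones - (n - real_of_int t) *\<^sub>R (P ** all_ones)"
    by (simp add: GP' matrix_arith)
  also have "\<dots> = 0"
    by (simp add: PJ flip: matrix_mul_assoc)
  finally have "c' = 0"
    by (auto simp: all_ones_sq) (simp add: all_ones_def vec_eq_iff)
  have "n *\<^sub>R (P ** P) = G ** P + t *\<^sub>R P"
    by (simp add: GP)
  also have "\<dots> = n *\<^sub>R P"
    using \<open>c' = 0\<close> by (simp add: GP' algebra_simps)
  finally have "P ** P = P"
    using n by simp
  then show ?thesis
    using n latin_projection_symmetric by (simp add: symmetric_idempotent_def P_def)
qed

text \<open>The diagonal of \<open>G\<close> is zero, so the trace of the projection, which is its rank, depends only on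
  \<open>n\<close> and \<open>t\<close>.\<close>

lemma latin_projection_rank:
  assumes "has_valency G k"
  shows "rank (latin_projection n t G) = k"
proof -
  have "trace (latin_projection n t G) = (\<Sum>i\<in>(UNIV :: 'v set). (t - t / n) / n)"
    by (simp add: trace_def latin_projection_def latin_parameters_entries mat_def all_ones_def)
  also have "\<dots> = t * (real_of_int n - 1)"
    using latin_parameters_nonzero
    by (simp add: latin_parameters_card power2_eq_square field_simps)
  finally show ?thesis
    using latin_parameters_valency[OF assms]
      symmetric_idempotent_trace_eq_rank[OF latin_projection_symmetric_idempotent] by simp
qed

lemma latin_projection_eqI:
  assumes "has_valency G k" and F: "symmetric_idempotent F" "F ** all_ones = 0" "rank F = k"
    and GF: "G ** F = (real_of_int n - t) *\<^sub>R F"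
  shows "F = latin_projection n t G"
proof (rule symmetric_idempotent_eqI)
  have "transpose (F ** all_ones) = all_ones ** F"
    using F(1) by (simp add: matrix_transpose_mul symmetric_idempotent_def)
  then have "all_ones ** F = 0"
    by (simp add: F(2) linear_0[OF linear_transpose])
  then show "latin_projection n t G ** F = F"
    using latin_parameters_nonzero by (simp add: latin_projection_def matrix_arith GF algebra_simps)
qed (use assms latin_projection_rank latin_projection_symmetric_idempotent in simp_all)

text \<open>For \<open>n = 1\<close> the valency \<open>t (n - 1)\<close> would be 0, but a relation is a nonzero matrix. The order
  must differ from 1 for the valency to determine \<open>t\<close>.\<close>

lemma latin_parameters_order_ne_1: "n \<noteq> 1"
proof
  assume "n = 1"
  then have "G ** all_ones = 0"
    by (simp add: latin_parameters_mult_all_ones)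
  then have "(\<Sum>y\<in>UNIV. G $ x $ y) = 0" for x
    by (simp add: matrix_matrix_mult_def all_ones_def vec_eq_iff)
  moreover have "0 \<le> G $ x $ y" for x y
    using latin_parameters_entries(3)[of x y] by auto
  ultimately have "G $ x $ y = 0" for x y
    by (simp add: sum_nonneg_eq_0_iff)
  then show False
    using latin_parameters_entries(1) by (simp add: vec_eq_iff)
qed

end

section \<open>Refining a relation of an association scheme\<close>

text \<open>Only the closure under products has to be supplied when one relation is split: the supports of
  the parts are disjoint from each other and from the remaining relations because all sums of
  entries are at most 1, so the parts are distinct and the count is right. Products in the order
  \<open>D i ** M\<close> follow by transposition, as everything in the span is symmetric.\<close>

lemma association_scheme_refine:
  fixes B :: "real ^ 'v ^ 'v" and D :: "'i \<Rightarrow> real ^ 'v ^ 'v"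
  assumes scheme: "association_scheme (d + 1) (insert B C)" and "mat 1 \<in> C" "B \<notin> C"
    and "finite I" and B: "B = (\<Sum>i\<in>I. D i)"
    and D: "\<And>i. i \<in> I \<Longrightarrow> D i \<noteq> 0" "\<And>i. i \<in> I \<Longrightarrow> transpose (D i) = D i"
      "\<And>i x y. i \<in> I \<Longrightarrow> D i $ x $ y \<in> {0, 1}"
    and CD: "\<And>M i. M \<in> C \<Longrightarrow> i \<in> I \<Longrightarrow> M ** D i \<in> span (C \<union> D ` I)"
    and DD: "\<And>i j. i \<in> I \<Longrightarrow> j \<in> I \<Longrightarrow> D i ** D j \<in> span (C \<union> D ` I)"
  shows "association_scheme (d + card I) (C \<union> D ` I)"
proof -
  let ?S = "C \<union> D ` I"
  note old = association_schemeD[OF scheme]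
  have "finite C" and cardC: "card C = d + 1" and sum: "B + (\<Sum>M\<in>C. M) = all_ones"
    using old(1,2,4) \<open>B \<notin> C\<close> by auto
  have C_nonneg: "0 \<le> M $ x $ y" if "M \<in> insert B C" for M x y
    using old(7)[OF that, of x y] by auto
  have D_nonneg: "0 \<le> D i $ x $ y" if "i \<in> I" for i x y
    using D(3)[OF that, of x y] by auto
  have support: "\<exists>x y. D i $ x $ y = 1" if i: "i \<in> I" for i
  proof -
    obtain x y where "D i $ x $ y \<noteq> 0"
      using D(1)[OF i] by (auto simp: vec_eq_iff)
    then show ?thesis
      using D(3)[OF i, of x y] by auto
  qed
  have B_01: "B $ x $ y \<in> {0, 1}" for x y
    by (simp only: old(7) insertI1)
  have B_entry: "B $ x $ y = (\<Sum>i\<in>I. D i $ x $ y)" for x y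
    by (simp add: B)
  have inj: "inj_on D I"
  proof (rule inj_onI, rule ccontr)
    fix i j assume ij: "i \<in> I" "j \<in> I" "D i = D j" "i \<noteq> j"
    obtain x y where xy: "D i $ x $ y = 1"
      using support[OF ij(1)] by blast
    have "(\<Sum>l\<in>{i, j}. D l $ x $ y) \<le> (\<Sum>l\<in>I. D l $ x $ y)"
      using ij D_nonneg \<open>finite I\<close> by (intro sum_mono2) auto
    then have "2 \<le> B $ x $ y"
      using ij xy B_entry by simp
    then show False
      using B_01[of x y] by auto
  qed
  have disj: "C \<inter> D ` I = {}"
  proof (rule ccontr)
    assume "C \<inter> D ` I \<noteq> {}"
    then obtain i where i: "i \<in> I" "D i \<in> C"
      by blast
    obtain x y where xy: "D i $ x $ y = 1"
      using support[OF i(1)] by blast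
    have "1 \<le> B $ x $ y"
      using member_le_sum[of i I "\<lambda>i. D i $ x $ y"] i(1) \<open>finite I\<close> D_nonneg xy B_entry by simp
    moreover have "1 \<le> (\<Sum>M\<in>C. M $ x $ y)"
      using member_le_sum[of "D i" C "\<lambda>M. M $ x $ y"] i \<open>finite C\<close> C_nonneg xy by simp
    moreover have "B $ x $ y + (\<Sum>M\<in>C. M $ x $ y) = 1"
      using arg_cong[OF sum, of "\<lambda>M. M $ x $ y"] by (simp add: all_ones_def)
    ultimately show False by simp
  qed
  have card: "card ?S = d + card I + 1"
    using card_Un_disjoint[OF \<open>finite C\<close> _ disj] \<open>finite I\<close> inj cardC by (simp add: card_image)
  have sum_S: "(\<Sum>M\<in>?S. M) = all_ones"
    using sum.union_disjoint[OF \<open>finite C\<close> _ disj, of "\<lambda>M. M"] \<open>finite I\<close> sum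
    by (simp add: sum.reindex[OF inj] B add.commute)
  have "B \<in> span ?S"
    unfolding B by (intro span_sum span_base) auto
  then have span_old: "span (insert B C) \<subseteq> span ?S"
    by (intro span_minimal subspace_span) (auto intro: span_base)
  have sym: "transpose X = X" if "X \<in> span ?S" for X
    using linear_eq_on_span[OF linear_transpose linear_ident _ that] old(6) D(2) by auto
  have DC: "D i ** M \<in> span ?S" if "M \<in> C" "i \<in> I" for M i
    using sym[OF CD[OF that]] CD[OF that] old(6)[of M] D(2)[OF that(2)] that
    by (simp add: matrix_transpose_mul)
  have CC: "M ** N \<in> span ?S" if "M \<in> C" "N \<in> C" for M N
    using bose_mesner_mult[OF scheme] span_old that by (meson insertCI span_base subsetD)
  have "M ** N \<in> span ?S" if "M \<in> span ?S" "N \<in> span ?S" for M N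
    by (rule span_mult_closed[OF _ that]) (use CC CD DC DD in auto)
  moreover have "M \<noteq> 0 \<and> transpose M = M \<and> (\<forall>x y. M $ x $ y \<in> {0, 1})" if M: "M \<in> ?S" for M
  proof (cases "M \<in> C")
    case True
    then show ?thesis
      using old(5,6,7)[of M] by simp
  next
    case False
    then obtain i where "i \<in> I" "M = D i"
      using M by blast
    then show ?thesis
      using D[of i] by simp
  qed
  ultimately show ?thesis
    unfolding association_scheme_def
    using card sum_S \<open>finite C\<close> \<open>finite I\<close> \<open>mat 1 \<in> C\<close> by (intro conjI ballI) simp_all
qed

section \<open>Decomposing the graph\<close>

text \<open>The summands may have different parameters \<open>T i\<close>, but they share \<open>n\<close>. This makes the
  passage to projections additive and turns \<open>B = \<Sum> D i\<close> into \<open>F = \<Sum> P i\<close>.\<close>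

lemma latin_decomposition_refines:
  fixes n s :: int and T :: "'i \<Rightarrow> int" and B :: "real ^ 'v ^ 'v" and D :: "'i \<Rightarrow> real ^ 'v ^ 'v"
  assumes scheme: "association_scheme (d + 1) (insert B C)" and "mat 1 \<in> C" "B \<notin> C"
    and prim: "latin_projection n s B \<in> primitive_idempotents (insert B C)"
    and B: "latin_parameters B n s"
    and "finite I" and sum: "B = (\<Sum>i\<in>I. D i)"
    and D: "\<And>i. i \<in> I \<Longrightarrow> latin_parameters (D i) n (T i)"
  shows "association_scheme (d + card I) (C \<union> D ` I)"
proof -
  let ?S = "C \<union> D ` I"
  define F where "F = latin_projection n s B"
  define P where "P i = latin_projection n (T i) (D i)" for i
  have n: "real_of_int n \<noteq> 0" "real_of_int n - 1 \<noteq> 0"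
    using latin_parameters_nonzero[OF B] latin_parameters_order_ne_1[OF B] by simp_all
  \<comment> \<open>Comparing valencies gives \<open>s = \<Sum> T i\<close>.\<close>
  have "(s * (real_of_int n - 1)) *\<^sub>R (all_ones :: real ^ 'v ^ 'v) = (\<Sum>i\<in>I. D i ** all_ones)"
    using latin_parameters_mult_all_ones[OF B] linear_sum[OF linear_mult_right[of all_ones], of D I]
    by (simp add: sum)
  also have "\<dots> = ((\<Sum>i\<in>I. real_of_int (T i)) * (real_of_int n - 1)) *\<^sub>R all_ones"
    by (simp add: latin_parameters_mult_all_ones[OF D] scaleR_sum_left sum_distrib_right)
  finally have s: "real_of_int s = (\<Sum>i\<in>I. real_of_int (T i))"
    using n by (auto simp: all_ones_def vec_eq_iff)
  have F_sum: "F = (\<Sum>i\<in>I. P i)"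
    by (simp add: F_def P_def latin_projection_def sum s sum.distrib sum_subtractf
        scaleR_sum_left sum_divide_distrib flip: scaleR_sum_right)
  have P: "symmetric_idempotent (P i)" if "i \<in> I" for i
    using latin_projection_symmetric_idempotent[OF D[OF that]] by (simp add: P_def)
  have F: "symmetric_idempotent F"
    using latin_projection_symmetric_idempotent[OF B] by (simp add: F_def)
  have PP: "P j ** P i = (if i = j then P i else 0)" if "i \<in> I" "j \<in> I" for i j
    using symmetric_idempotent_sum_orthogonal[of I P, OF \<open>finite I\<close> P F[unfolded F_sum] that]
      P[OF that(1)]
    by (auto simp: symmetric_idempotent_def)
  have FP: "F ** P i = P i" if "i \<in> I" for i
  proof -
    have "F ** P i = (\<Sum>j\<in>I. P j ** P i)"
      unfolding F_sum by (rule linear_sum[OF linear_mult_right])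
    then show ?thesis
      using that \<open>finite I\<close> by (simp add: PP)
  qed
  have "B \<in> span ?S"
    unfolding sum by (intro span_sum span_base) auto
  then have span_old: "span (insert B C) \<subseteq> span ?S"
    by (intro span_minimal subspace_span) (auto intro: span_base)
  have J: "all_ones \<in> span ?S"
    using bose_mesner_all_ones[OF scheme] span_old by blast
  have P_span: "P i \<in> span ?S" if "i \<in> I" for i
    unfolding P_def latin_projection_def
    using that J \<open>mat 1 \<in> C\<close> by (intro span_scale span_diff span_add) (auto intro: span_base)
  have XP: "X ** P i \<in> span ?S" if X: "X \<in> ?S" and i: "i \<in> I" for X i
  proof (cases "X \<in> C")
    case True
    then obtain c where "X ** F = c *\<^sub>R F"
      using bose_mesner_eigenvalue[OF scheme prim, of X] by (auto simp: F_def span_base)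
    then have "X ** P i = c *\<^sub>R P i"
      using FP[OF i] by (metis matrix_mul_assoc matrix_mult_scaleR_left)
    then show ?thesis
      using P_span[OF i] by (simp add: span_scale)
  next
    case False
    then obtain j where j: "j \<in> I" "X = D j"
      using X by blast
    have "X = n *\<^sub>R P j - T j *\<^sub>R mat 1 + (T j / n) *\<^sub>R all_ones"
      unfolding j P_def by (rule latin_projection_inverse[OF n(1)])
    then have "X ** P i = n *\<^sub>R (P j ** P i) - T j *\<^sub>R P i + (T j / n) *\<^sub>R (all_ones ** P i)"
      by (simp add: matrix_arith)
    also have "\<dots> = (if i = j then n - T j else - T j) *\<^sub>R P i"
      using all_ones_mult_latin_projection[OF D[OF i]] PP[OF i j(1)]
      by (simp add: P_def algebra_simps)
    finally show ?thesis
      using P_span[OF i] by (simp add: span_scale del: of_int_diff)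
  qed
  have XJ: "X ** all_ones \<in> span ?S" if "X \<in> ?S" for X
  proof (cases "X \<in> C")
    case True
    then show ?thesis
      using bose_mesner_mult[OF scheme _ bose_mesner_all_ones[OF scheme], of X] span_old
      by (auto simp: span_base)
  next
    case False
    then show ?thesis
      using that J by (auto simp: latin_parameters_mult_all_ones[OF D] span_scale)
  qed
  have XD: "X ** D i \<in> span ?S" if "X \<in> ?S" "i \<in> I" for X i
  proof -
    have "D i = n *\<^sub>R P i - T i *\<^sub>R mat 1 + (T i / n) *\<^sub>R all_ones"
      unfolding P_def by (rule latin_projection_inverse[OF n(1)])
    then have "X ** D i = n *\<^sub>R (X ** P i) - T i *\<^sub>R X + (T i / n) *\<^sub>R (X ** all_ones)"
      by (simp add: matrix_arith)
    also have "\<dots> \<in> span ?S"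
      using that XP XJ by (intro span_add span_diff span_scale) (auto intro: span_base)
    finally show ?thesis .
  qed
  show ?thesis
    by (rule association_scheme_refine[OF scheme \<open>mat 1 \<in> C\<close> \<open>B \<notin> C\<close> \<open>finite I\<close> sum])
      (use latin_parameters_entries[OF D] XD in auto)
qed

theorem theorem4p2:
  fixes n :: int and k e f :: nat and t :: real
    and A E Bs :: "nat \<Rightarrow> real ^ 'v ^ 'v"
    and B F :: "real ^ 'v ^ 'v"
  assumes "int CARD('v) = n\<^sup>2"
    and "association_scheme (e + 1) ({mat 1} \<union> A ` {1..e} \<union> {B})"
    and "nontrivial_idempotents ({mat 1} \<union> A ` {1..e} \<union> {B}) = {F} \<union> E ` {1..e}"
    and "(n > 0 \<and> latin_square_type B) \<or> (n < 0 \<and> negative_latin_square_type B)"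
    and "has_valency B k"
    and "rank F = k"
    and "t = real k / (of_int n - 1)"
    and "B ** F = (of_int n - t) *\<^sub>R F"
    and "real k \<noteq> (of_int n ^ 2 - 1) / 2"
    and "B = (\<Sum>i=1..f. Bs i)"
    and "\<forall>i\<in>{1..f}. strongly_regular (Bs i)"
    and "latin_square_type B \<longrightarrow> (\<forall>i\<in>{1..f}. latin_square_type (Bs i))"
    and "negative_latin_square_type B \<longrightarrow> (\<forall>i\<in>{1..f}. negative_latin_square_type (Bs i))"
  shows "association_scheme (e + f) ({mat 1} \<union> A ` {1..e} \<union> Bs ` {1..f})"
proof -
  let ?C = "{mat 1} \<union> A ` {1..e}"
  have old: "{mat 1} \<union> A ` {1..e} \<union> {B} = insert B ?C"
    by auto
  have scheme: "association_scheme (e + 1) (insert B ?C)"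
    using assms(2) by (simp only: old)
  have "card ?C \<le> card {mat 1 :: real ^ 'v ^ 'v} + card (A ` {1..e})"
    by (rule card_Un_le)
  also have "\<dots> \<le> e + 1"
    using card_image_le[of "{1..e}" A] by simp
  finally have "B \<notin> ?C"
    using association_schemeD(2)[OF scheme] by (auto simp: insert_absorb)
  \<comment> \<open>The number of vertices fixes the order up to its sign, which the type determines.\<close>
  have order: "m = n" if "latin_parameters G m s" "0 < m \<and> 0 < n \<or> m < 0 \<and> n < 0"
    for G :: "real ^ 'v ^ 'v" and m s
    using that assms(1) by (auto simp: latin_parameters_def power2_eq_iff)
  have "(\<exists>s. latin_parameters B n s) \<and> (\<forall>i\<in>{1..f}. \<exists>s. latin_parameters (Bs i) n s)"
    using assms(4)
  proof
    assume *: "n > 0 \<and> latin_square_type B"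
    then have "\<exists>s. latin_parameters G n s" if "latin_square_type G" for G :: "real ^ 'v ^ 'v"
      using that order by (auto simp: latin_square_type_def)
    with * assms(12) show ?thesis by blast
  next
    assume *: "n < 0 \<and> negative_latin_square_type B"
    then have "\<exists>s. latin_parameters G n s" if "negative_latin_square_type G" for G :: "real ^ 'v ^ 'v"
      using that order by (auto simp: negative_latin_square_type_def)
    with * assms(13) show ?thesis by blast
  qed
  then obtain s T where B: "latin_parameters B n s"
    and Bs: "\<And>i. i \<in> {1..f} \<Longrightarrow> latin_parameters (Bs i) n (T i)"
    by metis
  have "t = s"
    using latin_parameters_valency[OF B assms(5)] latin_parameters_order_ne_1[OF B] assms(7)
    by simp
  have F: "F \<in> nontrivial_idempotents (insert B ?C)"
    using assms(3) unfolding old by simp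
  then have prim: "F \<in> primitive_idempotents (insert B ?C)"
    by (simp add: nontrivial_idempotents_def)
  have "F = latin_projection n s B"
    using latin_projection_eqI[OF B assms(5) primitive_symmetric_idempotent[OF scheme prim]
        nontrivial_idempotent_mult_all_ones[OF scheme F] assms(6)] assms(8) \<open>t = s\<close>
    by simp
  then have "association_scheme (e + card {1..f}) (?C \<union> Bs ` {1..f})"
    using latin_decomposition_refines[OF scheme _ \<open>B \<notin> ?C\<close> _ B _ assms(10) Bs] prim by simp
  then show ?thesis
    by simp
qed

end
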